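(* Let $\lambda\ge0$, let $\boldsymbol{M}^T$ be a matrix with $r$ rows and $k+1$ columns, $\mathrm{rank}(\boldsymbol{M})=r$, let $\boldsymbol{m}$ be a vector of order $r$ of specified constants, and let $G_0$ be the null model distribution having true parameter value $\boldsymbol{\beta}_0$, with $\boldsymbol{M}^T\boldsymbol{\beta}_0=\boldsymbol{m}$. The second order influence function of the Wald-type test statistic at $G_0$ and contamination point $\boldsymbol{w}=(\boldsymbol{x}_t,y_t)$ is given by $$\mathcal{IF}_2(\boldsymbol{w},W_\lambda,G_0)=\mathcal{IF}^T(\boldsymbol{w},\boldsymbol{T}_\lambda,G_0)\,\boldsymbol{M}\left(\boldsymbol{M}^T\boldsymbol{\Sigma}_\lambda(\boldsymbol{\beta}_0)\boldsymbol{M}\right)^{-1}\boldsymbol{M}^T\,\mathcal{IF}(\boldsymbol{w},\boldsymbol{T}_\lambda,G_0)$$ $$=\widetilde{\Psi}_\lambda^2(\boldsymbol{x}_t^T\boldsymbol{\beta}_0,y_t)\,\boldsymbol{x}_t^T\boldsymbol{J}_\lambda^{-1}(\boldsymbol{\beta}_0)\boldsymbol{M}\left(\boldsymbol{M}^T\boldsymbol{\Sigma}_\lambda(\boldsymbol{\beta}_0)\boldsymbol{M}\right)^{-1}\boldsymbol{M}^T\boldsymbol{J}_\lambda^{-1}(\boldsymbol{\beta}_0)\boldsymbol{x}_t.$$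
   Context: $G_0$ is the joint distribution of $(\boldsymbol{X},Y)$ where $\boldsymbol{X}\in\mathbb{R}^{k+1}$ (first coordinate equal to 1) has distribution function $H$ with support $\mathcal{X}$, and $Y\in\{0,1\}$ with $P_{G_0}(Y=1\mid\boldsymbol{X}=\boldsymbol{x})=\pi(\boldsymbol{x}^T\boldsymbol{\beta}_0)$, $\pi(s)=e^s/(1+e^s)$. Put $$\widetilde{\Psi}_\lambda(s,y)=\frac{(e^{\lambda s}+e^s)(e^s-y(1+e^s))}{(1+e^s)^{\lambda+2}},\qquad \boldsymbol{\Psi}_\lambda(\boldsymbol{x},y,\boldsymbol{\beta})=\widetilde{\Psi}_\lambda(\boldsymbol{x}^T\boldsymbol{\beta},y)\,\boldsymbol{x},$$ and $\boldsymbol{\Sigma}_\lambda(\boldsymbol{\beta})=\boldsymbol{J}_\lambda^{-1}(\boldsymbol{\beta})\boldsymbol{K}_\lambda(\boldsymbol{\beta})\boldsymbol{J}_\lambda^{-1}(\boldsymbol{\beta})$ with $$\boldsymbol{J}_\lambda(\boldsymbol{\beta})=\int_{\mathcal{X}}\frac{e^{\lambda\boldsymbol{x}^T\boldsymbol{\beta}}+e^{\boldsymbol{x}^T\boldsymbol{\beta}}}{(1+e^{\boldsymbol{x}^T\boldsymbol{\beta}})^{\lambda+3}}e^{\boldsymbol{x}^T\boldsymbol{\beta}}\boldsymbol{x}\boldsymbol{x}^T\,dH(\boldsymbol{x}),\qquad \boldsymbol{K}_\lambda(\boldsymbol{\beta})=\int_{\mathcal{X}}\frac{(e^{\lambda\boldsymbol{x}^T\boldsymbol{\beta}}+e^{\boldsymbol{x}^T\boldsymbol{\beta}})^2}{(1+e^{\boldsymbol{x}^T\boldsymbol{\beta}})^{2(\lambda+2)}}e^{\boldsymbol{x}^T\boldsymbol{\beta}}\boldsymbol{x}\boldsymbol{x}^T\,dH(\boldsymbol{x}).$$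 The minimum density power divergence functional $\boldsymbol{T}_\lambda(G)$ at a joint distribution $G$ is the solution in $\boldsymbol{\beta}$ of $E_G[\boldsymbol{\Psi}_\lambda(\boldsymbol{X},Y,\boldsymbol{\beta})]=\boldsymbol{0}$, whenever it exists; $\boldsymbol{T}_\lambda(G_0)=\boldsymbol{\beta}_0$. Given a sample $(\boldsymbol{x}_i,y_i)$, $i=1,\dots,n$, the minimum density power divergence estimator $\widehat{\boldsymbol{\beta}}_\lambda$ solves $\sum_{i=1}^n\boldsymbol{\Psi}_\lambda(\boldsymbol{x}_i,y_i,\boldsymbol{\beta})=\boldsymbol{0}$. The Wald-type test statistic for $H_0:\boldsymbol{M}^T\boldsymbol{\beta}=\boldsymbol{m}$ is $W_n=n(\boldsymbol{M}^T\widehat{\boldsymbol{\beta}}_\lambda-\boldsymbol{m})^T(\boldsymbol{M}^T\boldsymbol{\Sigma}_\lambda(\widehat{\boldsymbol{\beta}}_\lambda)\boldsymbol{M})^{-1}(\boldsymbol{M}^T\widehat{\boldsymbol{\beta}}_\lambda-\boldsymbol{m})$, and the associated statistical functional (ignoring the multiplier $n$) is $$W_\lambda(G)=(\boldsymbol{M}^T\boldsymbol{T}_\lambda(G)-\boldsymbol{m})^T\left(\boldsymbol{M}^T\boldsymbol{\Sigma}_\lambda(\widehat{\boldsymbol{\beta}}_\lambda)\boldsymbol{M}\right)^{-1}(\boldsymbol{M}^T\boldsymbol{T}_\lambda(G)-\boldsymbol{m}).$$ With $G_\varepsilon=(1-\varepsilon)G+\varepsilon\wedge_{\boldsymbol{w}}$,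 $\wedge_{\boldsymbol{w}}$ the point mass at $\boldsymbol{w}$, put $\mathcal{IF}(\boldsymbol{w},\boldsymbol{T}_\lambda,G)=\partial\boldsymbol{T}_\lambda(G_\varepsilon)/\partial\varepsilon|_{\varepsilon=0}$ and $\mathcal{IF}_2(\boldsymbol{w},\boldsymbol{T}_\lambda,G)=\partial^2\boldsymbol{T}_\lambda(G_\varepsilon)/\partial\varepsilon^2|_{\varepsilon=0}$. The second order influence function of the Wald-type test statistic at $G$ is defined as $$\mathcal{IF}_2(\boldsymbol{w},W_\lambda,G)=\left.\frac{\partial^2W_\lambda(G_\varepsilon)}{\partial\varepsilon^2}\right|_{\varepsilon=0}=(\boldsymbol{M}^T\boldsymbol{T}_\lambda(G)-\boldsymbol{m})^T\left(\boldsymbol{M}^T\boldsymbol{\Sigma}_\lambda(\boldsymbol{\beta})\boldsymbol{M}\right)^{-1}\boldsymbol{M}^T\mathcal{IF}_2(\boldsymbol{w},\boldsymbol{T}_\lambda,G)+\mathcal{IF}^T(\boldsymbol{w},\boldsymbol{T}_\lambda,G)\boldsymbol{M}\left(\boldsymbol{M}^T\boldsymbol{\Sigma}_\lambda(\boldsymbol{\beta})\boldsymbol{M}\right)^{-1}\boldsymbol{M}^T\mathcal{IF}(\boldsymbol{w},\boldsymbol{T}_\lambda,G),$$ with $\boldsymbol{\beta}$ the parameter value ($\boldsymbol{\beta}_0$ at $G_0$).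
   Formalization: The second order influence function of the Wald-type statistic is taken as the displayed two-term expression; the actual second derivative of W at 0 is proved to be twice that, since the stated equality between the two is off by a factor 2. *)

theory Defs
  imports "HOL-Probability.Probability"
begin

section \<open>The logistic model\<close>

definition logistic :: "real \<Rightarrow> real" where
  "logistic s = exp s / (1 + exp s)"

text \<open>
  \<open>H\<close> is the law of \<open>X\<close> and \<open>G\<close> the joint law of \<open>(X, Y)\<close>. The index \<open>i0\<close> designates the
  coordinate of \<open>X\<close> that is constantly 1, so the index type \<open>'p\<close> has \<open>k + 1\<close> elements. The last
  conjunct says \<open>P(Y = 1 | X = x) = logistic (x\<^sup>T \<beta>)\<close>: the sigma-algebra is the one generated by
  the first projection.
\<close>

definition logistic_model ::
    "'p::finite \<Rightarrow> (real^'p) measure \<Rightarrow> real^'p \<Rightarrow> ((real^'p) \<times> real) measure \<Rightarrow> bool" where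
  "logistic_model i0 H \<beta> G \<longleftrightarrow>
     prob_space G \<and> sets G = sets borel \<and> distr G borel fst = H \<and>
     (AE z in G. fst z $ i0 = 1 \<and> snd z \<in> {0, 1}) \<and>
     (AE z in G. real_cond_exp G (vimage_algebra (space G) fst borel) (indicator {z. snd z = 1}) z
                   = logistic (fst z \<bullet> \<beta>))"

definition measure_support :: "'a::topological_space measure \<Rightarrow> 'a set" where
  "measure_support H = {x. \<forall>U. open U \<and> x \<in> U \<longrightarrow> emeasure H U > 0}"

lemma AE_measure_support:
  fixes H :: "'a::second_countable_topology measure"
  assumes "sets H = sets borel"
  shows "AE x in H. x \<in> measure_support H"
proof -
  let ?F = "{U. open U \<and> emeasure H U = 0}"
  obtain F' where F': "F' \<subseteq> ?F" "countable F'" "\<Union>F' = \<Union>?F"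
    using Lindelof[of ?F] by auto
  have "\<Union>F' \<in> null_sets H"
    using F'(1,2) assms by (subst SUP_identity_eq[symmetric], intro null_sets_UN') (auto simp: null_sets_def)
  moreover have "{x \<in> space H. x \<notin> measure_support H} \<subseteq> \<Union>F'"
    unfolding F'(3) by (auto simp: measure_support_def not_gr_zero)
  ultimately show ?thesis
    by (rule AE_I')
qed


section \<open>Estimating function and asymptotic covariance\<close>

definition Psi_tilde :: "real \<Rightarrow> real \<Rightarrow> real \<Rightarrow> real" where
  "Psi_tilde lam s y =
     (exp (lam * s) + exp s) * (exp s - y * (1 + exp s)) / (1 + exp s) powr (lam + 2)"

definition Psi :: "real \<Rightarrow> real^'p::finite \<Rightarrow> real \<Rightarrow> real^'p \<Rightarrow> real^'p" where
  "Psi lam x y \<beta> = Psi_tilde lam (x \<bullet> \<beta>) y *\<^sub>R x"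

definition outer :: "real^'p::finite \<Rightarrow> real^'p^'p" where
  "outer x = (\<chi> i j. x $ i * x $ j)"

definition J_mat :: "real \<Rightarrow> (real^'p::finite) measure \<Rightarrow> real^'p \<Rightarrow> real^'p^'p" where
  "J_mat lam H \<beta> =
     (LINT x:measure_support H|H.
        ((exp (lam * (x \<bullet> \<beta>)) + exp (x \<bullet> \<beta>)) / (1 + exp (x \<bullet> \<beta>)) powr (lam + 3) * exp (x \<bullet> \<beta>))
          *\<^sub>R outer x)"

definition K_mat :: "real \<Rightarrow> (real^'p::finite) measure \<Rightarrow> real^'p \<Rightarrow> real^'p^'p" where
  "K_mat lam H \<beta> =
     (LINT x:measure_support H|H.
        ((exp (lam * (x \<bullet> \<beta>)) + exp (x \<bullet> \<beta>))\<^sup>2 / (1 + exp (x \<bullet> \<beta>)) powr (2 * (lam + 2))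
           * exp (x \<bullet> \<beta>)) *\<^sub>R outer x)"

definition Sigma_mat :: "real \<Rightarrow> (real^'p::finite) measure \<Rightarrow> real^'p \<Rightarrow> real^'p^'p" where
  "Sigma_mat lam H \<beta> =
     matrix_inv (J_mat lam H \<beta>) ** K_mat lam H \<beta> ** matrix_inv (J_mat lam H \<beta>)"


section \<open>The minimum density power divergence functional\<close>

text \<open>The estimating equation \<open>E\<^sub>G[Psi(X, Y, \<beta>)] = 0\<close>, including existence of the expectation.\<close>

definition mdpd_root :: "real \<Rightarrow> ((real^'p::finite) \<times> real) measure \<Rightarrow> real^'p \<Rightarrow> bool" where
  "mdpd_root lam G \<beta> \<longleftrightarrow> has_bochner_integral G (\<lambda>z. Psi lam (fst z) (snd z) \<beta>) 0"

text \<open>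
  \<open>T G\<close> solves the estimating equation at every joint law \<open>G\<close> at which it has a solution. If a law
  has several solutions, \<open>T\<close> may select any of them.
\<close>

definition mdpd_functional ::
    "real \<Rightarrow> (((real^'p::finite) \<times> real) measure \<Rightarrow> real^'p) \<Rightarrow> bool" where
  "mdpd_functional lam T \<longleftrightarrow>
     (\<forall>G. prob_space G \<and> sets G = sets borel \<and> (AE z in G. snd z \<in> {0, 1}) \<and>
          (\<exists>\<beta>. mdpd_root lam G \<beta>) \<longrightarrow> mdpd_root lam G (T G))"


section \<open>Contamination and influence functions\<close>

definition contaminate :: "'a measure \<Rightarrow> 'a \<Rightarrow> real \<Rightarrow> 'a measure" where
  "contaminate G w \<epsilon> =
     measure_of (space G) (sets G)
       (\<lambda>A. ennreal (1 - \<epsilon>) * emeasure G A + ennreal \<epsilon> * emeasure (return G w) A)"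

lemma space_contaminate [simp]: "space (contaminate G w \<epsilon>) = space G"
  by (simp add: contaminate_def)

lemma sets_contaminate [simp]: "sets (contaminate G w \<epsilon>) = sets G"
  by (simp add: contaminate_def)

lemma emeasure_contaminate:
  assumes "A \<in> sets G"
  shows "emeasure (contaminate G w \<epsilon>) A =
           ennreal (1 - \<epsilon>) * emeasure G A + ennreal \<epsilon> * indicator A w"
proof -
  have "emeasure (contaminate G w \<epsilon>) A =
          ennreal (1 - \<epsilon>) * emeasure G A + ennreal \<epsilon> * emeasure (return G w) A"
  proof (rule emeasure_measure_of[OF contaminate_def])
    show "countably_additive (sets (contaminate G w \<epsilon>))
        (\<lambda>A. ennreal (1 - \<epsilon>) * emeasure G A + ennreal \<epsilon> * emeasure (return G w) A)"
      unfolding countably_additive_def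
      by (auto simp: suminf_add[symmetric] ennreal_suminf_cmult suminf_emeasure suminf_indicator)
  qed (use assms sets.space_closed in \<open>auto simp: positive_def\<close>)
  with assms show ?thesis
    by simp
qed

lemma prob_space_contaminate:
  assumes "prob_space G" "w \<in> space G" "\<epsilon> \<in> {0..1}"
  shows "prob_space (contaminate G w \<epsilon>)"
proof
  interpret prob_space G by fact
  show "emeasure (contaminate G w \<epsilon>) (space (contaminate G w \<epsilon>)) = 1"
    using assms(2,3) by (simp add: emeasure_contaminate emeasure_space_1 flip: ennreal_plus)
qed

text \<open>
  All derivatives in \<open>\<epsilon>\<close> are taken within \<open>{0..1}\<close>, where the contaminated law is a probability
  measure; at 0 they are one-sided.
\<close>

definition contam_deriv :: "(real \<Rightarrow> 'b::real_normed_vector) \<Rightarrow> real \<Rightarrow> 'b" where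
  "contam_deriv f \<epsilon> = vector_derivative f (at \<epsilon> within {0..1})"

definition twice_diff_at_0 :: "(real \<Rightarrow> 'b::real_normed_vector) \<Rightarrow> bool" where
  "twice_diff_at_0 f \<longleftrightarrow>
     f differentiable (at 0 within {0..1}) \<and>
     (\<forall>\<^sub>F \<epsilon> in at_right 0. f differentiable (at \<epsilon> within {0..1})) \<and>
     contam_deriv f differentiable (at 0 within {0..1})"

definition IF1 :: "'a \<Rightarrow> ('a measure \<Rightarrow> 'b::real_normed_vector) \<Rightarrow> 'a measure \<Rightarrow> 'b" where
  "IF1 w T G = contam_deriv (\<lambda>\<epsilon>. T (contaminate G w \<epsilon>)) 0"

definition IF2 :: "'a \<Rightarrow> ('a measure \<Rightarrow> 'b::real_normed_vector) \<Rightarrow> 'a measure \<Rightarrow> 'b" where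
  "IF2 w T G = contam_deriv (contam_deriv (\<lambda>\<epsilon>. T (contaminate G w \<epsilon>))) 0"


section \<open>The Wald-type functional\<close>

definition wald_mat ::
    "real \<Rightarrow> (real^'p::finite) measure \<Rightarrow> real^'r::finite^'p \<Rightarrow> real^'p \<Rightarrow> real^'r^'r" where
  "wald_mat lam H M \<beta> = matrix_inv (transpose M ** Sigma_mat lam H \<beta> ** M)"

text \<open>
  The covariance matrix is evaluated at a parameter \<open>\<beta>\<close> and design law \<open>H\<close> that do not vary
  with \<open>G\<close>, so the contamination path enters through \<open>T\<close> only.
\<close>

definition wald_functional ::
    "real \<Rightarrow> (real^'p::finite) measure \<Rightarrow> real^'r::finite^'p \<Rightarrow> real^'r \<Rightarrow> real^'p \<Rightarrow>
     (((real^'p) \<times> real) measure \<Rightarrow> real^'p) \<Rightarrow> ((real^'p) \<times> real) measure \<Rightarrow> real" where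
  "wald_functional lam H M m \<beta> T G =
     (transpose M *v T G - m) \<bullet> (wald_mat lam H M \<beta> *v (transpose M *v T G - m))"

text \<open>
  Second order influence function of the Wald-type functional, in the normalisation that omits
  the factor 2 produced by differentiating a quadratic form twice: when \<open>T\<close> is twice
  differentiable along the contamination path and the Wald matrix is symmetric, it is half of
  \<open>IF2 w (wald_functional lam H M m \<beta> T) G\<close>.
\<close>

definition wald_IF2 ::
    "((real^'p::finite) \<times> real) \<Rightarrow> real \<Rightarrow> (real^'p) measure \<Rightarrow> real^'r::finite^'p \<Rightarrow> real^'r \<Rightarrow>
     real^'p \<Rightarrow> (((real^'p) \<times> real) measure \<Rightarrow> real^'p) \<Rightarrow> ((real^'p) \<times> real) measure \<Rightarrow> real" where
  "wald_IF2 w lam H M m \<beta> T G =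
     (transpose M *v T G - m) \<bullet> (wald_mat lam H M \<beta> *v (transpose M *v IF2 w T G)) +
     IF1 w T G \<bullet> ((M ** wald_mat lam H M \<beta> ** transpose M) *v IF1 w T G)"

end

theory Submission
  imports Defs
begin

text \<open>
  Along the contamination path \<open>b \<epsilon> = T (contaminate G0 w \<epsilon>)\<close> the estimating equation reads
  \<open>(1 - \<epsilon>) E[Psi(X, Y, b \<epsilon>)] + \<epsilon> Psi(w, b \<epsilon>) = 0\<close>, and \<open>E[Psi(X, Y, \<beta>0)] = 0\<close>. Since
  \<open>Psi_tilde\<close> is Lipschitz in its first argument and \<open>X\<close> is square integrable, dominated
  convergence for the difference quotients along the path gives, at \<open>\<epsilon> = 0\<close>,
  \<open>E[Psi_tilde'(X \<bullet> \<beta>0, Y) (X \<bullet> b' 0) X] = - Psi(w, \<beta>0)\<close>, and conditioning on \<open>X\<close> turns the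
  left-hand side into \<open>J (b' 0)\<close>. The Wald functional is a quadratic form in \<open>b \<epsilon> - b 0\<close>, so its
  second derivative at 0 is twice the form at \<open>b' 0\<close>.
\<close>

section \<open>Integration against a contaminated law\<close>

text \<open>Only the values of \<open>contaminate\<close> on sets are known, so the formula is built
  up by monotone induction on the integrand. It holds for every \<epsilon>, because
  \<open>ennreal\<close> truncates a negative weight to 0 on both sides.\<close>

lemma nn_integral_contaminate:
  assumes "w \<in> space G" and f: "f \<in> borel_measurable G"
  shows "nn_integral (contaminate G w \<epsilon>) f = ennreal (1 - \<epsilon>) * nn_integral G f + ennreal \<epsilon> * f w"
proof -
  have [measurable_cong]: "sets (contaminate G w \<epsilon>) = sets G" by simp
  from f show ?thesis
  proof (induction rule: borel_measurable_induct)
    case (cong f g)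
    have "nn_integral (contaminate G w \<epsilon>) f = nn_integral (contaminate G w \<epsilon>) g"
      using cong by (intro nn_integral_cong) simp
    moreover have "nn_integral G f = nn_integral G g"
      using cong by (intro nn_integral_cong) simp
    moreover have "f w = g w" using cong assms by simp
    ultimately show ?case using cong by simp
  next
    case (set A)
    then show ?case by (simp add: emeasure_contaminate)
  next
    case (mult u c)
    from mult(2)[measurable] mult(4) show ?case
      by (simp add: nn_integral_cmult distrib_left mult_ac)
  next
    case (add u v)
    have [measurable]: "u \<in> borel_measurable G" "v \<in> borel_measurable G" by fact+
    from add.IH show ?case
      by (simp add: nn_integral_add distrib_left add_ac)
  next
    case (seq U)
    have [measurable]: "\<And>i. U i \<in> borel_measurable G" by fact
    have SUP_U: "(SUP i. U i) = (\<lambda>x. SUP i. U i x)"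
      by (simp add: fun_eq_iff image_comp)
    have "nn_integral (contaminate G w \<epsilon>) (SUP i. U i)
        = (SUP i. nn_integral (contaminate G w \<epsilon>) (U i))"
      unfolding SUP_U by (rule nn_integral_monotone_convergence_SUP[OF seq(3)]) simp
    also have "\<dots> = (SUP i. ennreal (1 - \<epsilon>) * nn_integral G (U i) + ennreal \<epsilon> * U i w)"
      by (simp only: seq.IH)
    \<comment> \<open>Both sequences increase in \<open>i\<close>; this is what allows the supremum
      of the sum to be split.\<close>
    also have "\<dots> = (SUP i. ennreal (1 - \<epsilon>) * nn_integral G (U i)) + (SUP i. ennreal \<epsilon> * U i w)"
      using seq(3)
      by (intro ennreal_SUP_add)
        (auto simp: incseq_def le_fun_def intro!: mult_left_mono nn_integral_mono)
    also have "\<dots> = ennreal (1 - \<epsilon>) * nn_integral G (SUP i. U i) + ennreal \<epsilon> * (SUP i. U i) w"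
      unfolding SUP_U using seq(3)
      by (simp add: nn_integral_monotone_convergence_SUP SUP_mult_left_ennreal)
    finally show ?case by (simp only: seq(4))
  qed
qed

lemma integrable_contaminate:
  fixes f :: "'a \<Rightarrow> 'b::{banach, second_countable_topology}"
  assumes "w \<in> space G" "integrable G f"
  shows "integrable (contaminate G w \<epsilon>) f"
proof -
  have [measurable_cong]: "sets (contaminate G w \<epsilon>) = sets G" by simp
  have [measurable]: "f \<in> borel_measurable G" using assms by simp
  show ?thesis
    using assms by (auto simp: integrable_iff_bounded nn_integral_contaminate ennreal_mult_less_top)
qed

text \<open>Induction on integrable functions: indicators by computing measures, limits by dominated
  convergence under both laws. With \<epsilon> in the unit interval both weights are nonnegative, so
  nothing is truncated in the passage from \<open>ennreal\<close> to real numbers.\<close>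

lemma integral_contaminate:
  fixes f :: "'a \<Rightarrow> 'b::{banach, second_countable_topology}"
  assumes G: "finite_measure G" and w: "w \<in> space G" and \<epsilon>: "\<epsilon> \<in> {0..1}" and f: "integrable G f"
  shows "integral\<^sup>L (contaminate G w \<epsilon>) f = (1 - \<epsilon>) *\<^sub>R integral\<^sup>L G f + \<epsilon> *\<^sub>R f w"
  using f
proof (induction rule: integrable_induct)
  case (base A c)
  interpret finite_measure G by fact
  have "measure (contaminate G w \<epsilon>) A = (1 - \<epsilon>) * measure G A + \<epsilon> * indicator A w"
  proof -
    have "ennreal (1 - \<epsilon>) * ennreal (measure G A) + ennreal \<epsilon> * indicator A w
       = ennreal ((1 - \<epsilon>) * measure G A + \<epsilon> * indicator A w)"
      using \<epsilon> by (auto simp: indicator_def ennreal_mult)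
    then have "emeasure (contaminate G w \<epsilon>) A
        = ennreal ((1 - \<epsilon>) * measure G A + \<epsilon> * indicator A w)"
      using base by (simp only: emeasure_contaminate emeasure_eq_measure)
    then show ?thesis
      using \<epsilon> by (intro measure_eq_emeasure_eq_ennreal) auto
  qed
  moreover have "emeasure (contaminate G w \<epsilon>) A < \<infinity>"
    using base by (simp add: emeasure_contaminate ennreal_mult_less_top indicator_def)
  ultimately show ?case
    using base by (simp add: scaleR_add_left)
next
  case (add f g)
  then show ?case
    using w by (simp add: integrable_contaminate algebra_simps)
next
  case (lim f s)
  have "(\<lambda>i. integral\<^sup>L (contaminate G w \<epsilon>) (s i)) \<longlonglongrightarrow> integral\<^sup>L (contaminate G w \<epsilon>) f"
  proof (rule integral_dominated_convergence[where w = "\<lambda>x. 2 * norm (f x)"])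
    show "integrable (contaminate G w \<epsilon>) (\<lambda>x. 2 * norm (f x))"
      using lim w by (intro integrable_contaminate) auto
    show "f \<in> borel_measurable (contaminate G w \<epsilon>)" "\<And>i. s i \<in> borel_measurable (contaminate G w \<epsilon>)"
      by (rule borel_measurable_integrable[OF integrable_contaminate[OF w lim(4)]],
        rule borel_measurable_integrable[OF integrable_contaminate[OF w lim(1)]])
  qed (use lim in auto)
  moreover have "(\<lambda>i. integral\<^sup>L G (s i)) \<longlonglongrightarrow> integral\<^sup>L G f"
    by (rule integral_dominated_convergence[where w = "\<lambda>x. 2 * norm (f x)"]) (use lim in auto)
  \<comment> \<open>The point \<open>w\<close> may be null for \<open>G\<close>, so the term at
    \<open>w\<close> needs convergence of \<open>s i\<close> at every point of the space, which the
    induction principle provides.\<close>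
  then have "(\<lambda>i. (1 - \<epsilon>) *\<^sub>R integral\<^sup>L G (s i) + \<epsilon> *\<^sub>R s i w)
      \<longlonglongrightarrow> (1 - \<epsilon>) *\<^sub>R integral\<^sup>L G f + \<epsilon> *\<^sub>R f w"
    using lim(2)[OF w] by (intro tendsto_intros)
  ultimately show ?case
    unfolding lim.IH by (rule LIMSEQ_unique)
qed

lemma contaminate_0: "contaminate G w 0 = G"
  by (rule measure_eqI) (simp_all add: emeasure_contaminate)

text \<open>The exceptional set is null for \<open>G\<close> and does not contain \<open>w\<close>,
  hence both parts of the mixture give it mass 0.\<close>

lemma AE_contaminate:
  assumes "{z \<in> space G. P z} \<in> sets G" "AE z in G. P z" "P w"
  shows "AE z in contaminate G w \<epsilon>. P z"
proof -
  have N: "{z \<in> space G. \<not> P z} \<in> sets G"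
    using sets.Diff[OF sets.top assms(1)] by (auto intro: back_subst[of "\<lambda>A. A \<in> sets G"])
  then have "emeasure G {z \<in> space G. \<not> P z} = 0"
    using assms(2) by (simp add: AE_iff_measurable)
  then show ?thesis
    using N \<open>P w\<close> by (subst AE_iff_measurable[OF _ refl]) (simp_all add: emeasure_contaminate)
qed

section \<open>Derivatives along the contamination path\<close>

text \<open>Every point of the nondegenerate interval is a limit point of it, so derivatives within
  the interval are unique, also at the endpoint 0.\<close>

lemma contam_deriv_eq:
  assumes "(f has_vector_derivative d) (at \<epsilon> within {0..1})" "\<epsilon> \<in> {0..1}"
  shows "contam_deriv f \<epsilon> = d"
  using assms vector_derivative_within_cbox[of 0 1 \<epsilon> f d] by (simp add: contam_deriv_def)

lemma contam_deriv_works: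
  assumes "f differentiable (at \<epsilon> within {0..1})"
  shows "(f has_vector_derivative contam_deriv f \<epsilon>) (at \<epsilon> within {0..1})"
  using assms by (simp add: contam_deriv_def vector_derivative_works)

text \<open>In the second derivative at 0, every term containing the second derivative of
  \<open>u\<close> has the factor \<open>u 0 - u 0\<close>. The two surviving terms both equal
  \<open>prod\<close> at the first derivative in both slots, so they add up to a factor 2 without
  symmetry of \<open>prod\<close>.\<close>

lemma twice_diff_at_0_quadratic:
  fixes prod :: "'a::real_normed_vector \<Rightarrow> 'a \<Rightarrow> 'b::real_normed_vector"
  assumes prod: "bounded_bilinear prod" and u: "twice_diff_at_0 u"
  defines "g \<equiv> \<lambda>\<epsilon>. prod (u \<epsilon> - u 0) (u \<epsilon> - u 0)"
  shows "twice_diff_at_0 g"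
    and "contam_deriv (contam_deriv g) 0 = 2 *\<^sub>R prod (contam_deriv u 0) (contam_deriv u 0)"
proof -
  interpret bounded_bilinear prod by fact
  define u1 where "u1 = contam_deriv u"
  define g1 where "g1 = (\<lambda>\<epsilon>. prod (u \<epsilon> - u 0) (u1 \<epsilon>) + prod (u1 \<epsilon>) (u \<epsilon> - u 0))"
  have g: "(g has_vector_derivative g1 \<epsilon>) (at \<epsilon> within {0..1})"
    if "u differentiable (at \<epsilon> within {0..1})" for \<epsilon>
  proof -
    have "((\<lambda>\<epsilon>. u \<epsilon> - u 0) has_vector_derivative u1 \<epsilon>) (at \<epsilon> within {0..1})"
      using contam_deriv_works[OF that] by (auto intro!: derivative_eq_intros simp: u1_def)
    from has_vector_derivative[OF this this] show ?thesis
      unfolding g_def g1_def .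
  qed
  have u0: "u differentiable (at 0 within {0..1})"
    and ev: "\<forall>\<^sub>F \<epsilon> in at_right 0. u differentiable (at \<epsilon> within {0..1})"
    and u1: "u1 differentiable (at 0 within {0..1})"
    using u by (auto simp: twice_diff_at_0_def u1_def)
  \<comment> \<open>The product rule formula \<open>g1\<close> is known to be the derivative of
    \<open>g\<close> only where \<open>u\<close> is differentiable. Agreement near 0, together with
    agreement at 0 itself, suffices to transfer the derivative of \<open>g1\<close> at 0 to
    \<open>contam_deriv g\<close>.\<close>
  have ev': "\<forall>\<^sub>F \<epsilon> in at 0 within {0..1}. g1 \<epsilon> = contam_deriv g \<epsilon>"
  proof -
    have "\<forall>\<^sub>F \<epsilon> in at 0 within {0..1::real}. \<epsilon> \<in> {0..1}"
      by (auto simp: eventually_at_filter)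
    moreover have "\<forall>\<^sub>F \<epsilon> in at 0 within {0..1}. u differentiable (at \<epsilon> within {0..1})"
      using ev by (simp add: at_within_Icc_at_right)
    ultimately show ?thesis
      by eventually_elim (use g contam_deriv_eq in force)
  qed
  have d0: "((\<lambda>\<epsilon>. u \<epsilon> - u 0) has_vector_derivative u1 0) (at 0 within {0..1})"
    using contam_deriv_works[OF u0] by (auto intro!: derivative_eq_intros simp: u1_def)
  have "(g1 has_vector_derivative 2 *\<^sub>R prod (u1 0) (u1 0)) (at 0 within {0..1})"
    unfolding g1_def
    by (rule has_vector_derivative_eq_rhs, rule has_vector_derivative_add)
      (rule has_vector_derivative[OF d0 contam_deriv_works[OF u1]]
        has_vector_derivative[OF contam_deriv_works[OF u1] d0]
       | simp add: zero_left zero_right scaleR_2)+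
  then have g1: "(contam_deriv g has_vector_derivative 2 *\<^sub>R prod (u1 0) (u1 0)) (at 0 within {0..1})"
    unfolding has_vector_derivative_def
    using has_derivative_transform_eventually[OF _ ev'] contam_deriv_eq[OF g[OF u0]] by simp
  show "contam_deriv (contam_deriv g) 0 = 2 *\<^sub>R prod (contam_deriv u 0) (contam_deriv u 0)"
    using contam_deriv_eq[OF g1] by (simp add: u1_def)
  have "\<forall>\<^sub>F \<epsilon> in at_right 0. g differentiable (at \<epsilon> within {0..1})"
    using ev by (rule eventually_mono) (rule differentiableI_vector[OF g])
  then show "twice_diff_at_0 g"
    unfolding twice_diff_at_0_def
    using differentiableI_vector[OF g[OF u0]] differentiableI_vector[OF g1]
    by blast
qed

text \<open>Dominated convergence is applied to sequences, so the one-sided derivative is read off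
  along the points 1/(n+1), which lie in the interval and tend to 0.\<close>

lemma has_vector_derivative_imp_tendsto_quotient:
  assumes f: "(f has_vector_derivative d) (at 0 within {0..1})"
  shows "(\<lambda>n. (f (inverse (real (Suc n))) - f 0) /\<^sub>R inverse (real (Suc n))) \<longlonglongrightarrow> d"
proof -
  let ?e = "\<lambda>n. inverse (real (Suc n))"
  have "filterlim ?e (at 0 within {0..1}) sequentially"
    using LIMSEQ_inverse_real_of_nat
    by (auto simp: filterlim_at intro!: always_eventually simp: inverse_le_1_iff)
  then have "(\<lambda>n. (1 / norm (?e n - 0)) *\<^sub>R (f (?e n) - (f 0 + (?e n - 0) *\<^sub>R d))) \<longlonglongrightarrow> 0"
    using f unfolding has_vector_derivative_def has_derivative_within by (auto dest: filterlim_compose)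
  also have "(\<lambda>n. (1 / norm (?e n - 0)) *\<^sub>R (f (?e n) - (f 0 + (?e n - 0) *\<^sub>R d))) =
      (\<lambda>n. (f (?e n) - f 0) /\<^sub>R ?e n - d)"
    by (auto simp: fun_eq_iff scaleR_diff_right scaleR_add_right field_simps)
  finally show ?thesis
    by (simp only: LIM_zero_iff)
qed

section \<open>The estimating function\<close>

lemma logistic_bounds: "0 < logistic s" "logistic s < 1"
  by (auto simp: logistic_def add_pos_pos divide_simps)

lemma one_minus_logistic: "1 - logistic s = 1 / (1 + exp s)"
  using add_pos_pos[OF zero_less_one exp_gt_zero[of s]] by (simp add: logistic_def divide_simps)

lemma DERIV_logistic:
  "(logistic has_real_derivative logistic s * (1 - logistic s)) (at s)"
  unfolding logistic_def[abs_def] using add_pos_pos[OF zero_less_one exp_gt_zero[of s]]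
  by (auto intro!: derivative_eq_intros simp: divide_simps) (auto simp: algebra_simps power2_eq_square)

lemma continuous_on_logistic: "continuous_on A logistic"
  using DERIV_logistic by (meson DERIV_isCont continuous_at_imp_continuous_on)

text \<open>
  With \<open>p = logistic s\<close>, the estimating function factors as \<open>amp lam s * (p - y)\<close>. Written in terms of \<open>p\<close>
  and \<open>1 - p\<close>, its boundedness and that of its derivative are evident.
\<close>

definition amp :: "real \<Rightarrow> real \<Rightarrow> real" where
  "amp lam s = logistic s powr lam * (1 - logistic s) + logistic s * (1 - logistic s) powr lam"

text \<open>The chain rule produces powers with exponent \<open>lam - 1\<close>, unbounded near 0
  for small \<open>lam\<close>. The factor p(1 - p) from the derivative of \<open>logistic\<close>
  absorbs them, so only the exponent \<open>lam\<close> is left.\<close>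

definition amp_deriv :: "real \<Rightarrow> real \<Rightarrow> real" where
  "amp_deriv lam s =
     logistic s powr lam * (1 - logistic s) * (lam * (1 - logistic s) - logistic s)
     + logistic s * (1 - logistic s) powr lam * ((1 - logistic s) - lam * logistic s)"

lemma logistic_powr: "logistic s powr lam = exp (lam * s) / (1 + exp s) powr lam"
  by (simp add: logistic_def powr_divide exp_powr_real mult.commute)

lemma one_minus_logistic_powr: "(1 - logistic s) powr lam = 1 / (1 + exp s) powr lam"
  unfolding one_minus_logistic by (simp add: powr_divide)

lemma amp_eq: "amp lam s = (exp (lam * s) + exp s) / (1 + exp s) powr (lam + 1)"
proof -
  have "1 + exp s > 0" by (simp add: add_pos_pos)
  then show ?thesis
    unfolding amp_def logistic_powr one_minus_logistic_powr unfolding one_minus_logistic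
    by (simp add: logistic_def powr_add add_divide_distrib field_simps)
qed

lemma Psi_tilde_eq: "Psi_tilde lam s y = amp lam s * (logistic s - y)"
proof -
  have p: "1 + exp s > 0" by (simp add: add_pos_pos)
  have "(1 + exp s) powr (lam + 2) = (1 + exp s) powr (lam + 1) * (1 + exp s)"
    using p powr_add[of "1 + exp s" "lam + 1" 1] by (simp add: add.assoc)
  moreover have "logistic s - y = (exp s - y * (1 + exp s)) / (1 + exp s)"
    using p by (simp add: logistic_def field_simps)
  ultimately show ?thesis
    by (simp add: Psi_tilde_def amp_eq)
qed

text \<open>This identifies the weight in \<open>J_mat\<close> with the summand of the derivative of
  \<open>Psi_tilde\<close> that does not involve \<open>y\<close>.\<close>

lemma J_weight_eq:
  "(exp (lam * s) + exp s) / (1 + exp s) powr (lam + 3) * exp s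
     = amp lam s * (logistic s * (1 - logistic s))"
proof -
  have p: "1 + exp s > 0" by (simp add: add_pos_pos)
  have "(1 + exp s) powr (lam + 3) = (1 + exp s) powr (lam + 1) * (1 + exp s)\<^sup>2"
    using p powr_add[of "1 + exp s" "lam + 1" 2] by (simp add: add.assoc)
  then show ?thesis
    using p unfolding one_minus_logistic by (simp add: logistic_def amp_eq power2_eq_square)
qed

lemma DERIV_amp: "(amp lam has_real_derivative amp_deriv lam s) (at s)"
proof -
  have p: "0 < logistic s" "0 < 1 - logistic s" using logistic_bounds[of s] by auto
  \<comment> \<open>These identities remove the exponent \<open>lam - 1\<close> from the chain rule
    formulas \<open>d1\<close> and \<open>d3\<close> below.\<close>
  have a: "logistic s powr (lam - 1) * logistic s = logistic s powr lam"
    "(1 - logistic s) powr (lam - 1) * (1 - logistic s) = (1 - logistic s) powr lam"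
    using p by (simp_all add: powr_diff)
  have d1: "((\<lambda>s. logistic s powr lam) has_real_derivative
      lam * logistic s powr (lam - 1) * (logistic s * (1 - logistic s))) (at s)"
    using DERIV_chain2[OF has_real_derivative_powr[OF p(1)] DERIV_logistic] .
  have d2: "((\<lambda>s. 1 - logistic s) has_real_derivative - (logistic s * (1 - logistic s))) (at s)"
    using DERIV_logistic by (auto intro!: derivative_eq_intros)
  have d3: "((\<lambda>s. (1 - logistic s) powr lam) has_real_derivative
      lam * (1 - logistic s) powr (lam - 1) * - (logistic s * (1 - logistic s))) (at s)"
    using DERIV_chain2[OF has_real_derivative_powr[OF p(2)] d2] .
  have dp: "((\<lambda>s. logistic s powr lam) has_real_derivative
      lam * logistic s powr lam * (1 - logistic s)) (at s)"
    using d1 by (simp add: a(1)[symmetric] mult_ac)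
  have dq: "((\<lambda>s. (1 - logistic s) powr lam) has_real_derivative
      - (lam * (1 - logistic s) powr lam * logistic s)) (at s)"
    using d3 by (simp add: a(2)[symmetric] mult_ac)
  show ?thesis
    unfolding amp_def[abs_def]
    by (rule DERIV_cong[OF DERIV_add[OF DERIV_mult[OF dp d2] DERIV_mult[OF DERIV_logistic dq]]])
      (simp add: amp_deriv_def algebra_simps)
qed

section \<open>Uniform bounds and Lipschitz continuity of the estimating function\<close>

lemma abs_amp_le: "lam \<ge> 0 \<Longrightarrow> \<bar>amp lam s\<bar> \<le> 2"
proof -
  assume lam: "lam \<ge> 0"
  have p: "0 < logistic s" "logistic s < 1" by (fact logistic_bounds)+
  have "logistic s powr lam \<le> 1" "(1 - logistic s) powr lam \<le> 1"
    using p lam by (auto intro!: powr_le1)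
  then have "logistic s powr lam * (1 - logistic s) \<le> 1 * 1"
    "logistic s * (1 - logistic s) powr lam \<le> 1 * 1"
    using p by ((intro mult_mono; simp)+)
  moreover have "0 \<le> amp lam s"
    using p by (simp add: amp_def)
  ultimately show ?thesis by (simp add: amp_def)
qed

lemma abs_amp_deriv_le: "lam \<ge> 0 \<Longrightarrow> \<bar>amp_deriv lam s\<bar> \<le> 2 * lam + 2"
proof -
  assume lam: "lam \<ge> 0"
  have p: "0 < logistic s" "logistic s < 1" by (fact logistic_bounds)+
  have "logistic s powr lam \<le> 1" "(1 - logistic s) powr lam \<le> 1"
    using p lam by (auto intro!: powr_le1)
  then have 1: "logistic s powr lam * (1 - logistic s) \<le> 1 * 1"
    "logistic s * (1 - logistic s) powr lam \<le> 1 * 1"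
    using p by ((intro mult_mono; simp)+)
  have l: "lam * (1 - logistic s) \<le> lam" "lam * logistic s \<le> lam" "0 \<le> lam * (1 - logistic s)" "0 \<le> lam * logistic s"
    using p lam by (auto intro: mult_left_le)
  \<comment> \<open>Each summand of \<open>amp_deriv\<close> is a number in [0, 1] times one of
    these linear factors, which gives the total 2(lam + 1).\<close>
  have 2: "\<bar>lam * (1 - logistic s) - logistic s\<bar> \<le> lam + 1" "\<bar>(1 - logistic s) - lam * logistic s\<bar> \<le> lam + 1"
    using p l by linarith+
  have "\<bar>logistic s powr lam * (1 - logistic s) * (lam * (1 - logistic s) - logistic s)\<bar> \<le> 1 * (lam + 1)"
    unfolding abs_mult[of _ "lam * (1 - logistic s) - logistic s"]
    using p 1 2 lam by (intro mult_mono) auto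
  moreover have "\<bar>logistic s * (1 - logistic s) powr lam * ((1 - logistic s) - lam * logistic s)\<bar> \<le> 1 * (lam + 1)"
    unfolding abs_mult[of _ "(1 - logistic s) - lam * logistic s"]
    using p 1 2 lam by (intro mult_mono) auto
  ultimately show ?thesis
    unfolding amp_deriv_def by (intro order_trans[OF abs_triangle_ineq]) simp
qed

lemma continuous_on_amp: "continuous_on A (amp lam)"
  using DERIV_amp by (meson DERIV_isCont continuous_at_imp_continuous_on)

lemma continuous_on_amp_deriv: "continuous_on A (amp_deriv lam)"
  unfolding amp_deriv_def[abs_def]
  by (intro continuous_intros continuous_on_logistic)
     (use logistic_bounds in \<open>auto simp: less_imp_neq less_imp_neq[symmetric]\<close>)

text \<open>The product rule separates a multiple of the residual \<open>logistic s - y\<close>,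
  which averages out given X, from a term free of \<open>y\<close>, which becomes the weight of
  \<open>J_mat\<close>.\<close>

definition Psi_tilde_deriv :: "real \<Rightarrow> real \<Rightarrow> real \<Rightarrow> real" where
  "Psi_tilde_deriv lam s y =
     amp_deriv lam s * (logistic s - y) + amp lam s * (logistic s * (1 - logistic s))"

lemma DERIV_Psi_tilde:
  "((\<lambda>s. Psi_tilde lam s y) has_real_derivative Psi_tilde_deriv lam s y) (at s)"
  unfolding Psi_tilde_eq Psi_tilde_deriv_def using DERIV_amp DERIV_logistic
  by (auto intro!: derivative_eq_intros)

lemma abs_logistic_diff_le: "y \<in> {0, 1} \<Longrightarrow> \<bar>logistic s - y\<bar> \<le> 1"
  using logistic_bounds[of s] by auto

lemma abs_logistic_var_le: "\<bar>logistic s * (1 - logistic s)\<bar> \<le> 1"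
  unfolding abs_mult using logistic_bounds[of s] by (intro mult_le_one) auto

lemma abs_Psi_tilde_le: "lam \<ge> 0 \<Longrightarrow> y \<in> {0, 1} \<Longrightarrow> \<bar>Psi_tilde lam s y\<bar> \<le> 2"
  using mult_mono[OF abs_amp_le[of lam s] abs_logistic_diff_le[of y s]]
  by (simp add: Psi_tilde_eq abs_mult)

lemma abs_Psi_tilde_deriv_le:
  assumes "lam \<ge> 0" "y \<in> {0, 1}"
  shows "\<bar>Psi_tilde_deriv lam s y\<bar> \<le> 2 * lam + 4"
proof -
  have "\<bar>amp_deriv lam s * (logistic s - y)\<bar> \<le> (2 * lam + 2) * 1"
    unfolding abs_mult using assms abs_amp_deriv_le abs_logistic_diff_le by (intro mult_mono) auto
  moreover have "\<bar>amp lam s * (logistic s * (1 - logistic s))\<bar> \<le> 2 * 1"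
    unfolding abs_mult[of "amp lam s"]
    using assms abs_amp_le abs_logistic_var_le by (intro mult_mono) auto
  ultimately show ?thesis
    unfolding Psi_tilde_deriv_def by (intro order_trans[OF abs_triangle_ineq]) simp
qed

lemma Psi_tilde_Lipschitz:
  assumes "lam \<ge> 0" "y \<in> {0, 1}"
  shows "\<bar>Psi_tilde lam s y - Psi_tilde lam t y\<bar> \<le> (2 * lam + 4) * \<bar>s - t\<bar>"
  using field_differentiable_bound[of UNIV "\<lambda>s. Psi_tilde lam s y" "\<lambda>s. Psi_tilde_deriv lam s y"]
    DERIV_Psi_tilde abs_Psi_tilde_deriv_le[OF assms] by simp

lemma norm_Psi_le: "lam \<ge> 0 \<Longrightarrow> y \<in> {0, 1} \<Longrightarrow> norm (Psi lam x y \<beta>) \<le> 2 * norm x"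
  by (simp add: Psi_def mult_right_mono[OF abs_Psi_tilde_le])

text \<open>One factor \<open>norm x\<close> comes from Cauchy-Schwarz applied to the change in the
  linear predictor, the other from the vector \<open>x\<close> multiplying \<open>Psi_tilde\<close>.
  Hence the second moment of the design dominates the difference quotients.\<close>

lemma norm_Psi_diff_le:
  assumes "lam \<ge> 0" "y \<in> {0, 1}"
  shows "norm (Psi lam x y \<beta> - Psi lam x y \<beta>') \<le> (2 * lam + 4) * norm (\<beta> - \<beta>') * (norm x)\<^sup>2"
proof -
  have "norm (Psi lam x y \<beta> - Psi lam x y \<beta>')
      = \<bar>Psi_tilde lam (x \<bullet> \<beta>) y - Psi_tilde lam (x \<bullet> \<beta>') y\<bar> * norm x"
    by (simp add: Psi_def flip: scaleR_diff_left)
  also have "\<dots> \<le> ((2 * lam + 4) * \<bar>x \<bullet> (\<beta> - \<beta>')\<bar>) * norm x"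
    using Psi_tilde_Lipschitz[OF assms, of "x \<bullet> \<beta>" "x \<bullet> \<beta>'"]
    by (intro mult_right_mono) (simp_all add: inner_diff_right)
  also have "\<dots> \<le> ((2 * lam + 4) * (norm x * norm (\<beta> - \<beta>'))) * norm x"
    using assms by (intro mult_right_mono mult_left_mono Cauchy_Schwarz_ineq2) auto
  finally show ?thesis by (simp add: power2_eq_square mult_ac)
qed

lemma has_vector_derivative_Psi:
  assumes "(b has_vector_derivative b') (at \<epsilon> within S)"
  shows "((\<lambda>\<epsilon>. Psi lam x y (b \<epsilon>)) has_vector_derivative
           (Psi_tilde_deriv lam (x \<bullet> b \<epsilon>) y * (x \<bullet> b')) *\<^sub>R x) (at \<epsilon> within S)"
proof -
  have "((\<lambda>\<epsilon>. x \<bullet> b \<epsilon>) has_vector_derivative x \<bullet> b') (at \<epsilon> within S)"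
    using bounded_linear.has_vector_derivative[OF bounded_linear_inner_right assms] .
  then have "((\<lambda>\<epsilon>. x \<bullet> b \<epsilon>) has_real_derivative x \<bullet> b') (at \<epsilon> within S)"
    by (simp add: has_real_derivative_iff_has_vector_derivative)
  from DERIV_chain2[OF DERIV_Psi_tilde this]
  have "((\<lambda>\<epsilon>. Psi_tilde lam (x \<bullet> b \<epsilon>) y) has_vector_derivative
      Psi_tilde_deriv lam (x \<bullet> b \<epsilon>) y * (x \<bullet> b')) (at \<epsilon> within S)"
    by (simp add: has_real_derivative_iff_has_vector_derivative)
  from bounded_linear.has_vector_derivative[OF bounded_linear_scaleR_left this]
  show ?thesis unfolding Psi_def .
qed

section \<open>Measurability, the support of the design law, and the rank one matrices
  \<open>outer x\<close>\<close>

lemma borel_measurable_Psi: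
  fixes \<beta> :: "real^'p::finite"
  shows "(\<lambda>z. Psi lam (fst z) (snd z) \<beta>) \<in> borel_measurable borel"
  unfolding Psi_def Psi_tilde_eq
  by (intro borel_measurable_continuous_onI continuous_intros
    continuous_on_compose2[OF continuous_on_amp[of UNIV]]
    continuous_on_compose2[OF continuous_on_logistic[of UNIV]]) auto

lemma borel_measurable_logistic [measurable]: "logistic \<in> borel_measurable borel"
  by (intro borel_measurable_continuous_onI continuous_on_logistic)

lemma closed_measure_support: "closed (measure_support H)"
proof -
  have "- measure_support H = \<Union>{U. open U \<and> \<not> emeasure H U > 0}"
    by (auto simp: measure_support_def)
  then show ?thesis
    by (auto simp: closed_def)
qed

lemma outer_mult: "outer x *v b = (x \<bullet> b) *\<^sub>R x"
  unfolding vec_eq_iff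
proof
  fix i
  have "(outer x *v b) $ i = x $ i * (x \<bullet> b)"
    by (simp add: outer_def matrix_vector_mult_def inner_vec_def sum_distrib_left mult.assoc)
  then show "(outer x *v b) $ i = ((x \<bullet> b) *\<^sub>R x) $ i"
    by simp
qed

lemma norm_outer_le: "norm (outer (x::real^'p::finite)) \<le> CARD('p) * (norm x)\<^sup>2"
proof -
  \<comment> \<open>Row \<open>i\<close> is \<open>x $ i\<close> times \<open>x\<close>; bounding
    the norm by the sum over rows is crude but enough for integrability.\<close>
  have "norm (outer x) \<le> (\<Sum>i\<in>UNIV. norm (outer x $ i))"
    unfolding norm_vec_def by (rule L2_set_le_sum) auto
  also have "\<dots> \<le> (\<Sum>i\<in>(UNIV::'p set). (norm x)\<^sup>2)"
  proof (rule sum_mono)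
    fix i
    have "outer x $ i = (x $ i) *\<^sub>R x" by (simp add: outer_def vec_eq_iff)
    then show "norm (outer x $ i) \<le> (norm x)\<^sup>2"
      by (simp add: power2_eq_square mult_right_mono component_le_norm_cart)
  qed
  finally show ?thesis by simp
qed

lemma continuous_on_outer: "continuous_on A (outer :: real^'p::finite \<Rightarrow> _)"
  unfolding outer_def[abs_def] by (intro continuous_intros)

section \<open>Expectations under the logistic model\<close>

context
  fixes i0 :: "'p::finite" and H :: "(real^'p) measure" and \<beta> :: "real^'p"
    and G :: "((real^'p) \<times> real) measure"
  assumes model: "logistic_model i0 H \<beta> G"
begin

lemma prob_space_model: "prob_space G" and sets_model: "sets G = sets borel" and distr_model: "distr G borel fst = H"
  using model by (simp_all add: logistic_model_def)

lemma space_model: "space G = UNIV"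
  using sets_eq_imp_space_eq[OF sets_model] by simp

lemma AE_snd_model: "AE z in G. snd z \<in> {0, 1}"
  using model by (auto simp: logistic_model_def elim: AE_mp)

lemma measurable_fst_model [measurable]: "fst \<in> G \<rightarrow>\<^sub>M borel"
  by (simp add: measurable_cong_sets[OF sets_model refl] borel_measurable_continuous_onI continuous_on_fst)

lemma measurable_snd_model [measurable]: "snd \<in> G \<rightarrow>\<^sub>M borel"
  by (simp add: measurable_cong_sets[OF sets_model refl] borel_measurable_continuous_onI continuous_on_snd)

text \<open>Since \<open>f (fst z)\<close> is measurable for the sigma-algebra of X, the defining
  property of conditional expectation lets the success probability be replaced by the indicator of
  success under the integral.\<close>

lemma integral_residual_real:
  fixes f :: "real^'p \<Rightarrow> real"
  assumes f[measurable]: "f \<in> borel_measurable borel" and int: "integrable G (\<lambda>z. f (fst z))"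
  shows "(\<integral>z. (logistic (fst z \<bullet> \<beta>) - snd z) * f (fst z) \<partial>G) = 0"
proof -
  interpret G: prob_space G by (fact prob_space_model)
  define F where "F = vimage_algebra (space G) fst (borel :: (real^'p) measure)"
  \<comment> \<open>The model prescribes the conditional expectation of this indicator; it agrees
    with \<open>snd\<close> almost everywhere because Y takes only the values 0 and 1.\<close>
  define I :: "(real^'p) \<times> real \<Rightarrow> real" where "I = indicator {z. snd z = 1}"
  have "subalgebra G F"
    using measurable_sets[OF measurable_fst_model]
    by (auto simp: subalgebra_def F_def sets_vimage_algebra2 space_model)
  then interpret finite_measure_subalgebra G F
    by unfold_locales
  have I [measurable]: "I \<in> borel_measurable G"
  proof -
    have "{z. snd z = 1} = snd -` {1::real} \<inter> space G"
      by (auto simp: space_model)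
    then show ?thesis
      unfolding I_def by (metis borel_measurable_indicator borel_singleton measurable_sets measurable_snd_model sets.empty_sets)
  qed
  have fF: "(\<lambda>z. f (fst z)) \<in> borel_measurable F"
    unfolding F_def by (rule measurable_compose[OF measurable_vimage_algebra1 f]) auto
  have intI: "integrable G (\<lambda>z. f (fst z) * I z)"
    by (rule Bochner_Integration.integrable_bound[OF int]) (auto simp: I_def indicator_def)
  have intl: "integrable G (\<lambda>z. f (fst z) * logistic (fst z \<bullet> \<beta>))"
    by (rule Bochner_Integration.integrable_bound[OF int])
      (auto simp: abs_mult logistic_bounds less_imp_le intro!: mult_left_le)
  have "(\<integral>z. f (fst z) * logistic (fst z \<bullet> \<beta>) \<partial>G) = (\<integral>z. f (fst z) * real_cond_exp G F I z \<partial>G)"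
    using model by (intro integral_cong_AE) (auto simp: logistic_model_def F_def I_def elim: AE_mp)
  also have "\<dots> = (\<integral>z. f (fst z) * I z \<partial>G)"
    by (rule real_cond_exp_intg(2)[OF intI fF I])
  finally have eq: "(\<integral>z. f (fst z) * logistic (fst z \<bullet> \<beta>) - f (fst z) * I z \<partial>G) = 0"
    using intl intI by simp
  have "(\<integral>z. (logistic (fst z \<bullet> \<beta>) - snd z) * f (fst z) \<partial>G)
      = (\<integral>z. f (fst z) * logistic (fst z \<bullet> \<beta>) - f (fst z) * I z \<partial>G)"
    using AE_snd_model by (intro integral_cong_AE) (auto simp: I_def algebra_simps elim!: AE_mp)
  with eq show ?thesis by simp
qed

lemma integral_residual:
  fixes f :: "real^'p \<Rightarrow> real^'p"
  assumes f[measurable]: "f \<in> borel_measurable borel" and int: "integrable G (\<lambda>z. f (fst z))"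
  shows "integrable G (\<lambda>z. (logistic (fst z \<bullet> \<beta>) - snd z) *\<^sub>R f (fst z))"
    and "(\<integral>z. (logistic (fst z \<bullet> \<beta>) - snd z) *\<^sub>R f (fst z) \<partial>G) = 0"
proof -
  show i: "integrable G (\<lambda>z. (logistic (fst z \<bullet> \<beta>) - snd z) *\<^sub>R f (fst z))"
  proof (rule Bochner_Integration.integrable_bound[OF int])
    show "AE z in G. norm ((logistic (fst z \<bullet> \<beta>) - snd z) *\<^sub>R f (fst z)) \<le> norm (f (fst z))"
      using AE_snd_model
      by eventually_elim (simp add: mult_left_le_one_le abs_logistic_diff_le)
  qed simp
  \<comment> \<open>Testing against a constant vector reduces to the real case; choosing
    \<open>c\<close> to be the integral itself then forces it to vanish.\<close>
  have "c \<bullet> (\<integral>z. (logistic (fst z \<bullet> \<beta>) - snd z) *\<^sub>R f (fst z) \<partial>G) = 0" for c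
  proof -
    have "integrable G (\<lambda>z. c \<bullet> f (fst z))" using int by simp
    from integral_residual_real[OF _ this] i show ?thesis
      by (simp flip: integral_inner_right)
  qed
  then show "(\<integral>z. (logistic (fst z \<bullet> \<beta>) - snd z) *\<^sub>R f (fst z) \<partial>G) = 0"
    by (rule inner_eq_zero_iff[THEN iffD1])
qed

section \<open>Consequences of a finite second moment of the design\<close>

context
  assumes sq: "integrable H (\<lambda>x. (norm x)\<^sup>2)"
begin

lemma integrable_norm_sq: "integrable G (\<lambda>z. (norm (fst z))\<^sup>2)"
  using sq integrable_distr_eq[OF measurable_fst_model, of "\<lambda>x. (norm x)\<^sup>2"] by (simp add: distr_model)

lemma integrable_norm: "integrable G (\<lambda>z. norm (fst z))"
proof -
  interpret G: prob_space G by (fact prob_space_model)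
  \<comment> \<open>Nonnegativity of the square of \<open>norm x - 1/2\<close> gives this even with
    1/4 in place of 1; constants are integrable for a probability measure.\<close>
  have le: "norm (x::real^'p) \<le> 1 + (norm x)\<^sup>2" for x
    using zero_le_power2[of "norm x - 1/2"] by (simp add: power2_eq_square algebra_simps)
  show ?thesis
    by (rule Bochner_Integration.integrable_bound[of _ "\<lambda>z. 1 + (norm (fst z))\<^sup>2"])
      (use integrable_norm_sq le in auto)
qed

lemma borel_measurable_Psi_model: "(\<lambda>z. Psi lam (fst z) (snd z) b) \<in> borel_measurable G"
  using borel_measurable_Psi by (simp add: measurable_cong_sets[OF sets_model refl])

lemma integrable_Psi:
  assumes "lam \<ge> 0"
  shows "integrable G (\<lambda>z. Psi lam (fst z) (snd z) b)"
proof (rule Bochner_Integration.integrable_bound[of _ "\<lambda>z. 2 * norm (fst z)"])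
  show "AE z in G. norm (Psi lam (fst z) (snd z) b) \<le> norm (2 * norm (fst z))"
    using AE_snd_model by eventually_elim (simp add: norm_Psi_le[OF assms])
qed (use integrable_norm borel_measurable_Psi_model in auto)

text \<open>Fisher consistency: \<open>Psi\<close> at the true parameter is the residual times the
  function \<open>amp lam (x \<bullet> \<beta>) *\<^sub>R x\<close> of X alone, so
  \<open>integral_residual\<close> applies.\<close>

lemma integral_Psi_eq_0:
  assumes "lam \<ge> 0"
  shows "(\<integral>z. Psi lam (fst z) (snd z) \<beta> \<partial>G) = 0"
proof -
  have m: "(\<lambda>x. amp lam (x \<bullet> \<beta>) *\<^sub>R x) \<in> borel_measurable borel"
    by (intro borel_measurable_continuous_onI continuous_intros
      continuous_on_compose2[OF continuous_on_amp[of UNIV]]) auto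
  have "integrable G (\<lambda>z. amp lam (fst z \<bullet> \<beta>) *\<^sub>R fst z)"
    by (rule Bochner_Integration.integrable_bound[of _ "\<lambda>z. 2 * norm (fst z)"])
      (use integrable_norm measurable_compose[OF measurable_fst_model m] abs_amp_le[OF assms]
        in \<open>auto intro!: mult_right_mono\<close>)
  from integral_residual(2)[OF m this] show ?thesis
    by (simp add: Psi_def Psi_tilde_eq mult.commute)
qed

lemma J_mat_eq:
  assumes "lam \<ge> 0"
  defines "k \<equiv> \<lambda>x. amp lam (x \<bullet> \<beta>) * (logistic (x \<bullet> \<beta>) * (1 - logistic (x \<bullet> \<beta>)))"
  shows "integrable H (\<lambda>x. k x *\<^sub>R outer x)" and "J_mat lam H \<beta> = (\<integral>x. k x *\<^sub>R outer x \<partial>H)"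
proof -
  have sH: "sets H = sets borel" by (simp flip: distr_model)
  have m: "(\<lambda>x. k x *\<^sub>R outer x) \<in> borel_measurable H"
    unfolding measurable_cong_sets[OF sH refl] k_def
    by (intro borel_measurable_continuous_onI continuous_intros continuous_on_outer
      continuous_on_compose2[OF continuous_on_amp[of UNIV]]
      continuous_on_compose2[OF continuous_on_logistic[of UNIV]]) auto
  have k: "\<bar>k x\<bar> \<le> 2 * 1" for x
    unfolding k_def abs_mult[of "amp lam (x \<bullet> \<beta>)"]
    using abs_amp_le[OF assms(1)] abs_logistic_var_le by (intro mult_mono) auto
  show "integrable H (\<lambda>x. k x *\<^sub>R outer x)"
  proof (rule Bochner_Integration.integrable_bound)
    show "integrable H (\<lambda>x. 2 * (CARD('p) * (norm x)\<^sup>2))" using sq by simp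
    have "norm (k x *\<^sub>R outer x) \<le> 2 * (CARD('p) * (norm x)\<^sup>2)" for x
      using mult_mono[OF k norm_outer_le] by simp
    then show "AE x in H. norm (k x *\<^sub>R outer x) \<le> norm (2 * (CARD('p) * (norm x)\<^sup>2))"
      by simp
  qed (fact m)
  have [measurable]: "measure_support H \<in> sets H"
    using borel_closed[OF closed_measure_support] by (simp add: sH)
  have "(\<integral>x. indicator (measure_support H) x *\<^sub>R (k x *\<^sub>R outer x) \<partial>H) = (\<integral>x. k x *\<^sub>R outer x \<partial>H)"
  proof (rule integral_cong_AE)
    show "(\<lambda>x. indicator (measure_support H) x *\<^sub>R (k x *\<^sub>R outer x)) \<in> borel_measurable H"
      by (intro borel_measurable_scaleR borel_measurable_indicator m) simp
    show "AE x in H. indicator (measure_support H) x *\<^sub>R (k x *\<^sub>R outer x) = k x *\<^sub>R outer x"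
      using AE_measure_support[OF sH] by eventually_elim simp
  qed (fact m)
  then show "J_mat lam H \<beta> = (\<integral>x. k x *\<^sub>R outer x \<partial>H)"
    unfolding J_mat_def J_weight_eq set_lebesgue_integral_def k_def .
qed

text \<open>Applying a matrix to a fixed vector is bounded linear and so passes under the integral;
  a change of variables along \<open>fst\<close> then moves from \<open>H\<close> to the joint
  law.\<close>

lemma J_mat_mult:
  assumes "lam \<ge> 0"
  shows "J_mat lam H \<beta> *v b
    = (\<integral>z. (amp lam (fst z \<bullet> \<beta>) * (logistic (fst z \<bullet> \<beta>) * (1 - logistic (fst z \<bullet> \<beta>))) * (fst z \<bullet> b)) *\<^sub>R fst z \<partial>G)"
    (is "_ = (\<integral>z. (?k (fst z) * _) *\<^sub>R _ \<partial>G)")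
proof -
  have bl: "bounded_linear (\<lambda>A::real^'p^'p. A *v b)"
    unfolding linear_conv_bounded_linear[symmetric]
    by (intro linearI) (simp_all add: matrix_vector_mult_add_rdistrib scaleR_matrix_vector_assoc)
  have m: "(\<lambda>x. (?k x * (x \<bullet> b)) *\<^sub>R x) \<in> borel_measurable borel"
    by (intro borel_measurable_continuous_onI continuous_intros
      continuous_on_compose2[OF continuous_on_amp[of UNIV]]
      continuous_on_compose2[OF continuous_on_logistic[of UNIV]]) auto
  have "J_mat lam H \<beta> *v b = (\<integral>x. (?k x *\<^sub>R outer x) *v b \<partial>H)"
    using integral_bounded_linear[OF bl J_mat_eq(1)[OF assms]] J_mat_eq(2)[OF assms] by simp
  also have "\<dots> = (\<integral>x. (?k x * (x \<bullet> b)) *\<^sub>R x \<partial>H)"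
    by (simp add: outer_mult flip: scaleR_matrix_vector_assoc)
  also have "\<dots> = (\<integral>z. (?k (fst z) * (fst z \<bullet> b)) *\<^sub>R fst z \<partial>G)"
    using m by (simp add: integral_distr[OF measurable_fst_model] flip: distr_model)
  finally show ?thesis .
qed

text \<open>The integrand splits into the residual times a function of X, which integrates to 0, and
  a function of X alone, which is the integrand of \<open>J_mat_mult\<close>.\<close>

lemma integral_Psi_tilde_deriv:
  assumes "lam \<ge> 0"
  shows "(\<integral>z. (Psi_tilde_deriv lam (fst z \<bullet> \<beta>) (snd z) * (fst z \<bullet> b)) *\<^sub>R fst z \<partial>G) = J_mat lam H \<beta> *v b"
    and "(\<lambda>z. (Psi_tilde_deriv lam (fst z \<bullet> \<beta>) (snd z) * (fst z \<bullet> b)) *\<^sub>R fst z) \<in> borel_measurable G"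
proof -
  let ?k = "\<lambda>x. amp lam (x \<bullet> \<beta>) * (logistic (x \<bullet> \<beta>) * (1 - logistic (x \<bullet> \<beta>)))"
  define f where "f = (\<lambda>x. (amp_deriv lam (x \<bullet> \<beta>) * (x \<bullet> b)) *\<^sub>R x)"
  have m: "f \<in> borel_measurable borel" "(\<lambda>x. (?k x * (x \<bullet> b)) *\<^sub>R x) \<in> borel_measurable borel"
    unfolding f_def
    by (intro borel_measurable_continuous_onI continuous_intros
      continuous_on_compose2[OF continuous_on_amp[of UNIV]]
      continuous_on_compose2[OF continuous_on_amp_deriv[of UNIV]]
      continuous_on_compose2[OF continuous_on_logistic[of UNIV]]; auto)+
  have bound: "norm ((c * (x \<bullet> b)) *\<^sub>R x) \<le> C * norm b * (norm x)\<^sup>2" if "\<bar>c\<bar> \<le> C" for c C and x :: "real^'p"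
  proof -
    have "norm ((c * (x \<bullet> b)) *\<^sub>R x) = \<bar>c\<bar> * \<bar>x \<bullet> b\<bar> * norm x" by (simp add: abs_mult)
    also have "\<dots> \<le> C * (norm x * norm b) * norm x"
      using that by (intro mult_right_mono mult_mono Cauchy_Schwarz_ineq2) auto
    finally show ?thesis by (simp add: power2_eq_square mult_ac)
  qed
  have int: "integrable G (\<lambda>z. (c (fst z) * (fst z \<bullet> b)) *\<^sub>R fst z)"
    if "\<And>x. \<bar>c x\<bar> \<le> C" "(\<lambda>x. (c x * (x \<bullet> b)) *\<^sub>R x) \<in> borel_measurable borel" for c C
    by (rule Bochner_Integration.integrable_bound[of _ "\<lambda>z. C * norm b * (norm (fst z))\<^sup>2"])
      (use integrable_norm_sq measurable_compose[OF measurable_fst_model that(2)] order_trans[OF bound[OF that(1)] abs_ge_self]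
        in auto)
  have k: "\<bar>?k x\<bar> \<le> 2 * 1" for x
    unfolding abs_mult[of "amp lam (x \<bullet> \<beta>)"]
    using abs_amp_le[OF assms(1)] abs_logistic_var_le by (intro mult_mono) auto
  have if1: "integrable G (\<lambda>z. f (fst z))"
    unfolding f_def using abs_amp_deriv_le[OF assms] m(1)[unfolded f_def] by (rule int)
  have if2: "integrable G (\<lambda>z. (?k (fst z) * (fst z \<bullet> b)) *\<^sub>R fst z)"
    using k m(2) by (rule int)
  have eq: "(Psi_tilde_deriv lam (fst z \<bullet> \<beta>) (snd z) * (fst z \<bullet> b)) *\<^sub>R fst z
    = (logistic (fst z \<bullet> \<beta>) - snd z) *\<^sub>R f (fst z) + (?k (fst z) * (fst z \<bullet> b)) *\<^sub>R fst z" for z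
    by (simp add: Psi_tilde_deriv_def f_def algebra_simps)
  show "(\<integral>z. (Psi_tilde_deriv lam (fst z \<bullet> \<beta>) (snd z) * (fst z \<bullet> b)) *\<^sub>R fst z \<partial>G) = J_mat lam H \<beta> *v b"
    unfolding eq J_mat_mult[OF assms]
    using integral_residual[OF m(1) if1] if2 by (subst Bochner_Integration.integral_add) auto
  show "(\<lambda>z. (Psi_tilde_deriv lam (fst z \<bullet> \<beta>) (snd z) * (fst z \<bullet> b)) *\<^sub>R fst z) \<in> borel_measurable G"
    unfolding eq using integral_residual(1)[OF m(1) if1] if2 by (intro borel_measurable_add) auto
qed

text \<open>Implicit differentiation of the estimating equation, using differentiability of the path
  only at its endpoint 0. The result is left as a linear equation for the influence function, to be
  solved by inverting \<open>J_mat\<close>.\<close>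

lemma J_mat_mult_IF1:
  assumes lam: "lam \<ge> 0" and y: "y \<in> {0, 1}" and T: "mdpd_functional lam T" "T G = \<beta>"
    and root: "\<forall>\<^sub>F \<epsilon> in at_right 0. \<exists>\<beta>. mdpd_root lam (contaminate G (x, y) \<epsilon>) \<beta>"
    and diff: "(\<lambda>\<epsilon>. T (contaminate G (x, y) \<epsilon>)) differentiable (at 0 within {0..1})"
  shows "J_mat lam H \<beta> *v IF1 (x, y) T G = - Psi lam x y \<beta>"
proof -
  interpret G: prob_space G by (fact prob_space_model)
  define b where "b = (\<lambda>\<epsilon>. T (contaminate G (x, y) \<epsilon>))"
  define d where "d = IF1 (x, y) T G"
  define e where "e = (\<lambda>n. inverse (real (Suc n)))"
  have b: "(b has_vector_derivative d) (at 0 within {0..1})"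
    using contam_deriv_works[OF diff] unfolding b_def d_def IF1_def .
  have b0: "b 0 = \<beta>" by (simp add: b_def contaminate_0 T)
  have e01: "e n \<in> {0..1}" "e n > 0" "e n \<noteq> 0" for n by (auto simp: e_def inverse_le_1_iff)
  have e0: "e \<longlonglongrightarrow> 0" unfolding e_def by (rule LIMSEQ_inverse_real_of_nat)
  have q: "(\<lambda>n. (b (e n) - \<beta>) /\<^sub>R e n) \<longlonglongrightarrow> d"
    using has_vector_derivative_imp_tendsto_quotient[OF b] by (simp add: e_def b0)
  \<comment> \<open>Convergent difference quotients of the path are bounded; \<open>C\<close> enters
    the dominating function for \<open>D n\<close> through the Lipschitz estimate.\<close>
  obtain C where C: "\<And>n. norm ((b (e n) - \<beta>) /\<^sub>R e n) \<le> C"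
    using convergent_imp_Bseq[OF convergentI[OF q]] unfolding Bseq_def by blast
  define D where "D = (\<lambda>n z. (Psi lam (fst z) (snd z) (b (e n)) - Psi lam (fst z) (snd z) \<beta>) /\<^sub>R e n)"
  have "(\<lambda>n. integral\<^sup>L G (D n)) \<longlonglongrightarrow>
      (\<integral>z. (Psi_tilde_deriv lam (fst z \<bullet> \<beta>) (snd z) * (fst z \<bullet> d)) *\<^sub>R fst z \<partial>G)"
  proof (rule integral_dominated_convergence[where w = "\<lambda>z. (2 * lam + 4) * C * (norm (fst z))\<^sup>2"])
    show "(\<lambda>z. (Psi_tilde_deriv lam (fst z \<bullet> \<beta>) (snd z) * (fst z \<bullet> d)) *\<^sub>R fst z) \<in> borel_measurable G"
      by (rule integral_Psi_tilde_deriv(2)[OF lam])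
    show "D n \<in> borel_measurable G" for n
      unfolding D_def using borel_measurable_Psi_model by measurable
    show "integrable G (\<lambda>z. (2 * lam + 4) * C * (norm (fst z))\<^sup>2)"
      using integrable_norm_sq by simp
    show "AE z in G. (\<lambda>n. D n z) \<longlonglongrightarrow> (Psi_tilde_deriv lam (fst z \<bullet> \<beta>) (snd z) * (fst z \<bullet> d)) *\<^sub>R fst z"
      using has_vector_derivative_imp_tendsto_quotient[OF has_vector_derivative_Psi[OF b]]
      by (intro AE_I2) (simp add: D_def e_def b0)
    show "AE z in G. norm (D n z) \<le> (2 * lam + 4) * C * (norm (fst z))\<^sup>2" for n
      using AE_snd_model
    proof eventually_elim
      case (elim z)
      have "norm (D n z) \<le> ((2 * lam + 4) * norm (b (e n) - \<beta>) * (norm (fst z))\<^sup>2) / e n"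
        using divide_right_mono[OF norm_Psi_diff_le[OF lam elim, of "fst z" "b (e n)" \<beta>], of "e n"] e01(2)[of n]
        by (simp add: D_def divide_inverse mult.commute[of _ "inverse (e n)"])
      also have "\<dots> = (2 * lam + 4) * norm ((b (e n) - \<beta>) /\<^sub>R e n) * (norm (fst z))\<^sup>2"
        using e01(2)[of n] by (simp add: divide_inverse)
      also have "\<dots> \<le> (2 * lam + 4) * C * (norm (fst z))\<^sup>2"
        using C lam by (intro mult_right_mono mult_left_mono) auto
      finally show ?case .
    qed
  qed
  then have "(\<lambda>n. (1 - e n) *\<^sub>R integral\<^sup>L G (D n)) \<longlonglongrightarrow> (1 - 0) *\<^sub>R (J_mat lam H \<beta> *v d)"
    unfolding integral_Psi_tilde_deriv(1)[OF lam] using e0 by (intro tendsto_intros)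
  \<comment> \<open>This is the estimating equation under contamination \<open>e n\<close>, divided
    by \<open>e n\<close>. It is available only for large \<open>n\<close>, since roots are assumed
    to exist only for small contamination.\<close>
  moreover have "\<forall>\<^sub>F n in sequentially. (1 - e n) *\<^sub>R integral\<^sup>L G (D n) = - Psi lam x y (b (e n))"
  proof -
    have "filterlim e (at_right 0) sequentially"
      using e0 e01 by (auto simp: filterlim_at intro!: always_eventually)
    from eventually_compose_filterlim[OF root this] show ?thesis
    proof eventually_elim
      case (elim n)
      let ?C = "contaminate G (x, y) (e n)"
      \<comment> \<open>The functional \<open>T\<close> is tied to the estimating equation only at
        laws with binary response, so the contaminating response must be binary as well.\<close>
      have "AE z in ?C. snd z \<in> {0, 1}"
      proof (rule AE_contaminate)
        have "{z \<in> space G. snd z \<in> {0, 1}} = snd -` {0, 1} \<inter> space G" by auto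
        then show "{z \<in> space G. snd z \<in> {0, 1}} \<in> sets G"
          using measurable_sets[OF measurable_snd_model, of "{0, 1}"] by simp
      qed (use AE_snd_model y in auto)
      then have "mdpd_root lam ?C (b (e n))"
        using elim T(1) prob_space_contaminate[OF prob_space_model _ e01(1)]
        unfolding mdpd_functional_def b_def by (simp add: space_model sets_model)
      then have "(\<integral>z. Psi lam (fst z) (snd z) (b (e n)) \<partial>?C) = 0"
        by (simp add: mdpd_root_def has_bochner_integral_iff)
      then have "(1 - e n) *\<^sub>R (\<integral>z. Psi lam (fst z) (snd z) (b (e n)) \<partial>G) + e n *\<^sub>R Psi lam x y (b (e n)) = 0"
        using integral_contaminate[OF G.finite_measure_axioms _ e01(1) integrable_Psi[OF lam]]
        by (simp add: space_model)
      \<comment> \<open>The expectation subtracted inside \<open>D n\<close> is zero by Fisher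
        consistency.\<close>
      moreover have "(\<integral>z. Psi lam (fst z) (snd z) (b (e n)) \<partial>G) = e n *\<^sub>R integral\<^sup>L G (D n)"
        using e01(2)[of n] integrable_Psi[OF lam] integral_Psi_eq_0[OF lam]
        by (simp add: D_def)
      ultimately have "e n *\<^sub>R ((1 - e n) *\<^sub>R integral\<^sup>L G (D n) + Psi lam x y (b (e n))) = 0"
        by (simp add: scaleR_add_right mult.commute)
      then show ?case
        using e01(2)[of n] by (simp add: eq_neg_iff_add_eq_0)
    qed
  qed
  \<comment> \<open>Differentiability of the path at 0 yields its continuity there, and with it the
    limit of the right-hand side.\<close>
  moreover have "(\<lambda>n. - Psi lam x y (b (e n))) \<longlonglongrightarrow> - Psi lam x y \<beta>"
  proof (intro tendsto_minus)
    have "continuous (at 0 within {0..1}) (\<lambda>\<epsilon>. Psi lam x y (b \<epsilon>))"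
      using has_vector_derivative_continuous[OF has_vector_derivative_Psi[OF b]] .
    then have "((\<lambda>\<epsilon>. Psi lam x y (b \<epsilon>)) \<longlongrightarrow> Psi lam x y \<beta>) (at 0 within {0..1})"
      by (simp add: continuous_within b0)
    moreover have "filterlim e (at 0 within {0..1}) sequentially"
      using e0 e01 by (auto simp: filterlim_at intro!: always_eventually)
    ultimately show "(\<lambda>n. Psi lam x y (b (e n))) \<longlonglongrightarrow> Psi lam x y \<beta>"
      by (rule filterlim_compose)
  qed
  ultimately have "(1 - 0) *\<^sub>R (J_mat lam H \<beta> *v d) = - Psi lam x y \<beta>"
    by (rule LIMSEQ_unique[OF Lim_transform_eventually])
  then show ?thesis
    by (simp add: d_def)
qed

text \<open>Transposition commutes with the integral and fixes each \<open>outer x\<close>. The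
  symmetry is used to move the inverse across an inner product.\<close>

lemma transpose_J_mat:
  assumes "lam \<ge> 0"
  shows "transpose (J_mat lam H \<beta>) = J_mat lam H \<beta>"
proof -
  have bl: "bounded_linear (transpose :: real^'p^'p \<Rightarrow> _)"
    unfolding linear_conv_bounded_linear[symmetric]
    by (intro linearI) (simp_all add: transpose_def vec_eq_iff)
  have "transpose (c *\<^sub>R outer x) = c *\<^sub>R outer x" for c and x :: "real^'p"
    by (simp add: transpose_def outer_def vec_eq_iff mult.commute)
  then show ?thesis
    using integral_bounded_linear[OF bl J_mat_eq(1)[OF assms]] J_mat_eq(2)[OF assms] by simp
qed

end

end

section \<open>The influence functions\<close>

lemma matrix_inv_mult:
  fixes A :: "real^'n::finite^'n"
  assumes "invertible A"
  shows "matrix_inv A ** A = mat 1" "A ** matrix_inv A = mat 1"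
proof -
  have "\<exists>B. A ** B = mat 1 \<and> B ** A = mat 1" using assms by (simp add: invertible_def)
  from someI_ex[OF this] show "matrix_inv A ** A = mat 1" "A ** matrix_inv A = mat 1"
    by (simp_all add: matrix_inv_def)
qed

lemma transpose_matrix_inv_symmetric:
  fixes A :: "real^'n::finite^'n"
  assumes "invertible A" "transpose A = A"
  shows "transpose (matrix_inv A) = matrix_inv A"
proof -
  have "transpose (matrix_inv A) = transpose (matrix_inv A) ** (A ** matrix_inv A)"
    using assms by (simp add: matrix_inv_mult)
  also have "\<dots> = transpose (A ** matrix_inv A) ** matrix_inv A"
    using assms(2) by (simp add: matrix_transpose_mul matrix_mul_assoc)
  finally show ?thesis using assms(1) by (simp add: matrix_inv_mult transpose_mat)
qed

lemma inner_matrix_vector: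
  fixes A :: "real^'n::finite^'m::finite"
  shows "x \<bullet> (A *v y) = (transpose A *v x) \<bullet> y"
  by (metis dot_lmul_matrix vector_transpose_matrix transpose_transpose)

theorem theorem14:
  fixes lam :: real
    and i0 :: "'p::finite"
    and H :: "(real^'p) measure"
    and G0 :: "((real^'p) \<times> real) measure"
    and \<beta>0 :: "real^'p"
    and M :: "real^'r::finite^'p"
    and m :: "real^'r"
    and T :: "((real^'p) \<times> real) measure \<Rightarrow> real^'p"
    and x_t :: "real^'p" and y_t :: real
  assumes "lam \<ge> 0"
    and "rank M = CARD('r)"
    and "transpose M *v \<beta>0 = m"
    and "logistic_model i0 H \<beta>0 G0"
    and "integrable H (\<lambda>x. (norm x)\<^sup>2)"
    and "invertible (J_mat lam H \<beta>0)"
    and "y_t \<in> {0, 1}"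
    and "mdpd_functional lam T"
    and "T G0 = \<beta>0"
    and "\<forall>\<^sub>F \<epsilon> in at_right 0. \<exists>\<beta>. mdpd_root lam (contaminate G0 (x_t, y_t) \<epsilon>) \<beta>"
    and "twice_diff_at_0 (\<lambda>\<epsilon>. T (contaminate G0 (x_t, y_t) \<epsilon>))"
  shows "wald_IF2 (x_t, y_t) lam H M m \<beta>0 T G0 =
           IF1 (x_t, y_t) T G0 \<bullet>
             ((M ** matrix_inv (transpose M ** Sigma_mat lam H \<beta>0 ** M) ** transpose M)
                *v IF1 (x_t, y_t) T G0) \<and>
         IF1 (x_t, y_t) T G0 \<bullet>
             ((M ** matrix_inv (transpose M ** Sigma_mat lam H \<beta>0 ** M) ** transpose M)
                *v IF1 (x_t, y_t) T G0) =
           (Psi_tilde lam (x_t \<bullet> \<beta>0) y_t)\<^sup>2 *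
             (x_t \<bullet> ((matrix_inv (J_mat lam H \<beta>0) ** M
                       ** matrix_inv (transpose M ** Sigma_mat lam H \<beta>0 ** M)
                       ** transpose M ** matrix_inv (J_mat lam H \<beta>0)) *v x_t)) \<and>
         twice_diff_at_0
           (\<lambda>\<epsilon>. wald_functional lam H M m \<beta>0 T (contaminate G0 (x_t, y_t) \<epsilon>)) \<and>
         IF2 (x_t, y_t) (wald_functional lam H M m \<beta>0 T) G0 =
           2 * wald_IF2 (x_t, y_t) lam H M m \<beta>0 T G0"
proof -
  define J where "J = J_mat lam H \<beta>0"
  \<comment> \<open>Absorbing \<open>M\<close> on both sides turns the Wald functional into a
    quadratic form on the parameter space.\<close>
  define W where "W = M ** wald_mat lam H M \<beta>0 ** transpose M"
  define u where "u = (\<lambda>\<epsilon>. T (contaminate G0 (x_t, y_t) \<epsilon>))"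
  define d where "d = IF1 (x_t, y_t) T G0"
  define psi where "psi = Psi_tilde lam (x_t \<bullet> \<beta>0) y_t"
  have u0: "u 0 = \<beta>0"
    by (simp add: u_def contaminate_0 assms(9))
  have d_eq: "d = contam_deriv u 0"
    by (simp add: d_def IF1_def u_def)
  have twice: "twice_diff_at_0 u"
    using assms(11) by (simp add: u_def)
  \<comment> \<open>The term with the second order influence function of \<open>T\<close> is
    multiplied by \<open>transpose M *v \<beta>0 - m\<close>, which is 0 under the null
    hypothesis.\<close>
  have IF2_eq: "wald_IF2 (x_t, y_t) lam H M m \<beta>0 T G0 = d \<bullet> (W *v d)"
    by (simp add: wald_IF2_def assms(3,9) d_def W_def del: transpose_matrix_vector)
  have Jd: "J *v d = (- psi) *\<^sub>R x_t"
    using J_mat_mult_IF1[OF assms(4,5,1,7,8,9,10)] assms(11)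
    by (simp add: twice_diff_at_0_def Psi_def J_def d_def psi_def)
  have "d = (matrix_inv J ** J) *v d"
    using assms(6) by (simp add: matrix_inv_mult J_def)
  also have "\<dots> = (- psi) *\<^sub>R (matrix_inv J *v x_t)"
    by (simp only: Jd matrix_vector_mult_scaleR flip: matrix_vector_mul_assoc)
  finally have d: "d = (- psi) *\<^sub>R (matrix_inv J *v x_t)" .
  have sym: "transpose (matrix_inv J) = matrix_inv J"
    using transpose_matrix_inv_symmetric[OF assms(6)] transpose_J_mat[OF assms(4,5,1)] by (simp add: J_def)
  \<comment> \<open>Each copy of \<open>d\<close> contributes a factor \<open>- psi\<close>, so the
    sign of the influence function cancels.\<close>
  have "d \<bullet> (W *v d) = psi\<^sup>2 * ((matrix_inv J *v x_t) \<bullet> (W *v (matrix_inv J *v x_t)))"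
    by (simp add: d matrix_vector_mult_scaleR power2_eq_square del: scaleR_minus_left)
  also have "\<dots> = psi\<^sup>2 * (x_t \<bullet> (matrix_inv J *v (W *v (matrix_inv J *v x_t))))"
    by (simp add: inner_matrix_vector[of x_t] sym)
  finally have quad: "d \<bullet> (W *v d)
      = psi\<^sup>2 * (x_t \<bullet> ((matrix_inv J ** M ** wald_mat lam H M \<beta>0 ** transpose M ** matrix_inv J) *v x_t))"
    by (simp add: W_def matrix_vector_mul_assoc matrix_mul_assoc)
  have bilin: "bounded_bilinear (\<lambda>a b :: real^'p. a \<bullet> (W *v b))"
    by (rule bounded_bilinear.comp[OF bounded_bilinear_inner bounded_linear_ident, unfolded id_def])
      (rule matrix_vector_mul_bounded_linear)
  \<comment> \<open>The null hypothesis replaces \<open>m\<close> by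
    \<open>transpose M *v u 0\<close>, so the functional is exactly a quadratic form in
    \<open>u \<epsilon> - u 0\<close>, with a matrix that does not depend on \<epsilon>.\<close>
  have wald: "(\<lambda>\<epsilon>. wald_functional lam H M m \<beta>0 T (contaminate G0 (x_t, y_t) \<epsilon>))
      = (\<lambda>\<epsilon>. (u \<epsilon> - u 0) \<bullet> (W *v (u \<epsilon> - u 0)))"
  proof
    fix \<epsilon>
    have "transpose M *v T (contaminate G0 (x_t, y_t) \<epsilon>) - m = transpose M *v (u \<epsilon> - u 0)"
      unfolding u0 by (simp add: u_def matrix_vector_mult_diff_distrib assms(3) del: transpose_matrix_vector)
    then show "wald_functional lam H M m \<beta>0 T (contaminate G0 (x_t, y_t) \<epsilon>)
        = (u \<epsilon> - u 0) \<bullet> (W *v (u \<epsilon> - u 0))"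
      by (simp add: wald_functional_def W_def inner_matrix_vector[of _ M]
        del: transpose_matrix_vector flip: matrix_vector_mul_assoc)
  qed
  note twice_diff_at_0_quadratic[OF bilin twice]
  then have "twice_diff_at_0 (\<lambda>\<epsilon>. wald_functional lam H M m \<beta>0 T (contaminate G0 (x_t, y_t) \<epsilon>))"
    and "IF2 (x_t, y_t) (wald_functional lam H M m \<beta>0 T) G0 = 2 * (d \<bullet> (W *v d))"
    unfolding IF2_def wald d_eq by simp_all
  with IF2_eq quad show ?thesis
    by (simp add: d_def W_def J_def psi_def wald_mat_def)
qed

end
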